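(* For every positive integer $n$, $3\left\lfloor\frac{n}{7}\right\rfloor\le\alpha'_g(P_n)\le 3\left\lceil\frac{n}{7}\right\rceil$.
   Context: $P_n$ denotes the path with $n$ vertices. The matching game on a graph $G$: two players, Max and Min, alternately add edges of $G$ to a set of chosen edges that must always remain a matching; the game ends when the chosen edges form a maximal matching of $G$ (no further edge can be added). Max wants the final matching to be large, Min wants it to be small. $\alpha'_g(G)$ denotes the size of the final matching under optimal play when Max moves first. *)

theory Defs
  imports Complex_Main
begin

text \<open>A graph is a pair of a vertex set and a set of edges, an edge being the set of its two
  endpoints.\<close>

type_synonym 'a graph = "'a set \<times> 'a set set"

definition verts :: "'a graph \<Rightarrow> 'a set" where
  "verts G = fst G"

definition edges :: "'a graph \<Rightarrow> 'a set set" where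
  "edges G = snd G"

definition finite_simple_graph :: "'a graph \<Rightarrow> bool" where
  "finite_simple_graph G \<longleftrightarrow> finite (verts G) \<and> (\<forall>e\<in>edges G. e \<subseteq> verts G \<and> card e = 2)"

definition path_graph :: "nat \<Rightarrow> nat graph" where
  "path_graph n = ({1..n}, {{i, i + 1} | i. 1 \<le> i \<and> i < n})"

definition matching :: "'a graph \<Rightarrow> 'a set set \<Rightarrow> bool" where
  "matching G M \<longleftrightarrow> M \<subseteq> edges G \<and> pairwise disjnt M"

definition maximal_matching :: "'a graph \<Rightarrow> 'a set set \<Rightarrow> bool" where
  "maximal_matching G M \<longleftrightarrow> matching G M \<and> (\<forall>e\<in>edges G - M. \<not> matching G (insert e M))"

definition legal_moves :: "'a graph \<Rightarrow> 'a set set \<Rightarrow> 'a set set" where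
  "legal_moves G M = {e \<in> edges G - M. matching G (insert e M)}"

datatype player = Maximizer | Minimizer

text \<open>\<open>game_value G p M\<close> is the size of the final matching under optimal play from the position
  in which \<open>M\<close> has been chosen and \<open>p\<close> is to move, by backward induction. Finiteness
  of the edge set only serves to make the recursion terminate; for graphs with infinitely many
  edges the value is meaningless.\<close>

function game_value :: "'a graph \<Rightarrow> player \<Rightarrow> 'a set set \<Rightarrow> nat" where
  "game_value G p M =
    (if finite (edges G) \<and> legal_moves G M \<noteq> {} then
       (case p of
          Maximizer \<Rightarrow> Max ((\<lambda>e. game_value G Minimizer (insert e M)) ` legal_moves G M)
        | Minimizer \<Rightarrow> Min ((\<lambda>e. game_value G Maximizer (insert e M)) ` legal_moves G M))
     else card M)"
  by pat_completeness auto
termination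
proof (relation "Wellfounded.measure (\<lambda>(G, p, M). card (edges G - M))")
  have *: "card (edges G - insert e M) < card (edges G - M)"
    if "finite (edges G) \<and> legal_moves G M \<noteq> {}" "e \<in> legal_moves G M"
    for G :: "'a graph" and M e
    using that by (intro psubset_card_mono) (auto simp: legal_moves_def)
  show "((G, Minimizer, insert e M), G, p, M)
      \<in> Wellfounded.measure (\<lambda>(G, p, M). card (edges G - M))"
    if "finite (edges G) \<and> legal_moves G M \<noteq> {}" "p = Maximizer" "e \<in> legal_moves G M"
    for G :: "'a graph" and p M e
    using *[OF that(1,3)] by simp
  show "((G, Maximizer, insert e M), G, p, M)
      \<in> Wellfounded.measure (\<lambda>(G, p, M). card (edges G - M))"
    if "finite (edges G) \<and> legal_moves G M \<noteq> {}" "p = Minimizer" "e \<in> legal_moves G M"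
    for G :: "'a graph" and p M e
    using *[OF that(1,3)] by simp
qed simp

declare game_value.simps [simp del]

definition game_matching_number :: "'a graph \<Rightarrow> nat" where
  "game_matching_number G = game_value G Maximizer {}"

lemma finite_simple_path_graph: "finite_simple_graph (path_graph n)"
  by (auto simp: finite_simple_graph_def path_graph_def verts_def edges_def)

lemma finite_edges:
  assumes "finite_simple_graph G"
  shows "finite (edges G)"
proof (rule finite_subset)
  show "edges G \<subseteq> Pow (verts G)" using assms by (auto simp: finite_simple_graph_def)
  show "finite (Pow (verts G))" using assms by (simp add: finite_simple_graph_def)
qed

text \<open>The positions without legal moves are exactly the maximal matchings.\<close>

lemma legal_moves_empty_iff:
  assumes "matching G M"
  shows "legal_moves G M = {} \<longleftrightarrow> maximal_matching G M"
  using assms by (auto simp: legal_moves_def maximal_matching_def)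

end

theory Submission
  imports Defs
begin

text \<open>A matching of \<open>P\<^sub>n\<close> is determined by the list of its gaps, the numbers of unmatched vertices
  before, between and after its edges, and a move replaces a gap \<open>a + b + 2\<close> by the two gaps \<open>a\<close>
  and \<open>b\<close>. Call a gap cold if it is \<open>0\<close>, \<open>1\<close>, \<open>2\<close>, \<open>3\<close> or \<open>5\<close>: a cold gap \<open>m\<close> admits exactly
  \<open>m div 2\<close> further moves, however they are played. Measure the game in sevenths of an edge and
  give a cold gap the weight \<open>7 * (m div 2)\<close>. If every other gap is given the weight \<open>3 * m - 3\<close>,
  then cutting off a gap \<open>2\<close> gains Max at least \<open>2\<close>, while no move of Min costs more than
  \<open>2\<close>. If instead it is given the weight \<open>3 * m + 1\<close>, then isolating a vertex gains Min at least
  \<open>2\<close>, while no move of Max gains more than \<open>2\<close>. The player with the gaining reply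
  thus always compensates the opponent's last move until only cold gaps are left. Since all weights
  of \<open>m\<close> lie between \<open>3 * m - 3\<close> and \<open>3 * m + 1\<close>, the value of \<open>P\<^sub>n\<close> lies between \<open>(3 * n - 3) / 7\<close>
  and \<open>(3 * n + 3) / 7\<close>, the first move of Max accounting for the difference of \<open>2\<close>.\<close>

section \<open>Backward induction\<close>

lemma game_value_no_moves:
  "legal_moves G M = {} \<Longrightarrow> game_value G p M = card M"
  by (subst game_value.simps) simp

lemma game_value_Maximizer:
  assumes "finite (edges G)" "legal_moves G M \<noteq> {}"
  shows "game_value G Maximizer M
    = Max (game_value G Minimizer ` (\<lambda>e. insert e M) ` legal_moves G M)"
  using assms by (subst game_value.simps) (simp add: image_image)

lemma game_value_Minimizer:
  assumes "finite (edges G)" "legal_moves G M \<noteq> {}"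
  shows "game_value G Minimizer M
    = Min (game_value G Maximizer ` (\<lambda>e. insert e M) ` legal_moves G M)"
  using assms by (subst game_value.simps) (simp add: image_image)

section \<open>Matchings of a path as lists of gaps\<close>

text \<open>The \<open>2\<close> counts the edge after each gap. With the guard edge included, a
  matching of the path with \<open>n\<close> vertices has extent \<open>n + 2\<close>.\<close>

definition extent :: "nat list \<Rightarrow> nat" where
  "extent gs = sum_list gs + 2 * length gs"

lemma extent_simps [simp]:
  "extent [] = 0" "extent (g # gs) = g + 2 + extent gs" "extent (xs @ ys) = extent xs + extent ys"
  by (simp_all add: extent_def)

text \<open>Every gap, including the last one, is followed by an edge. The edge after the last gap is
  a guard outside the path, which keeps the recursion uniform.\<close>

fun edge_starts :: "nat \<Rightarrow> nat list \<Rightarrow> nat set" where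
  "edge_starts p [] = {}"
| "edge_starts p (g # gs) = insert (p + g) (edge_starts (p + g + 2) gs)"

lemma finite_edge_starts [simp]: "finite (edge_starts p gs)"
  by (induction gs arbitrary: p) auto

lemma edge_starts_bounds:
  "j \<in> edge_starts p gs \<Longrightarrow> p \<le> j \<and> j + 2 \<le> p + extent gs"
proof (induction gs arbitrary: p)
  case (Cons g gs)
  then show ?case using Cons.IH[of "p + g + 2"] by fastforce
qed simp

lemma card_edge_starts: "card (edge_starts p gs) = length gs"
proof (induction gs arbitrary: p)
  case (Cons g gs)
  have "p + g \<notin> edge_starts (p + g + 2) gs"
    using edge_starts_bounds[of "p + g" "p + g + 2" gs] by auto
  then show ?case using Cons.IH by simp
qed simp

lemma edge_starts_apart:
  "i \<in> edge_starts p gs \<Longrightarrow> j \<in> edge_starts p gs \<Longrightarrow> i = j \<or> i + 2 \<le> j \<or> j + 2 \<le> i"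
proof (induction gs arbitrary: p)
  case (Cons g gs)
  then show ?case using Cons.IH[of "p + g + 2"] edge_starts_bounds[of _ "p + g + 2" gs] by fastforce
qed simp

lemma edge_starts_last:
  "gs \<noteq> [] \<Longrightarrow> p + extent gs - 2 \<in> edge_starts p gs"
proof (induction gs arbitrary: p)
  case (Cons g gs)
  show ?case
  proof (cases gs)
    case (Cons h hs)
    then show ?thesis using Cons.IH[of "p + g + 2"] by (simp add: add.assoc)
  qed simp
qed simp

lemma edge_starts_split:
  "edge_starts p (xs @ a # b # ys)
    = insert (p + extent xs + a) (edge_starts p (xs @ (a + b + 2) # ys))"
proof (induction xs arbitrary: p)
  case Nil
  show ?case by (auto simp: add_ac)
next
  case (Cons x xs)
  show ?case using Cons.IH[of "p + x + 2"] by (auto simp: add_ac)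
qed

text \<open>Every gap is closed by an edge on its right, so comparing \<open>i\<close> with the
  first edge either finds the gap or leaves a shorter list.\<close>

lemma free_start_split:
  assumes "p \<le> i" "i < p + extent gs" "\<And>j. j \<in> edge_starts p gs \<Longrightarrow> i + 2 \<le> j \<or> j + 2 \<le> i"
  shows "\<exists>xs a b ys. gs = xs @ (a + b + 2) # ys \<and> i = p + extent xs + a"
  using assms
proof (induction gs arbitrary: p)
  case (Cons g gs)
  have "i + 2 \<le> p + g \<or> p + g + 2 \<le> i" using Cons.prems(3)[of "p + g"] by simp
  then show ?case
  proof
    assume i: "i + 2 \<le> p + g"
    have "g # gs = [] @ ((i - p) + (p + g - i - 2) + 2) # gs" using i Cons.prems(1) by simp
    moreover have "i = p + extent [] + (i - p)" using Cons.prems(1) by simp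
    ultimately show ?thesis by blast
  next
    assume i: "p + g + 2 \<le> i"
    have "\<exists>xs a b ys. gs = xs @ (a + b + 2) # ys \<and> i = p + g + 2 + extent xs + a"
      using Cons.prems i by (intro Cons.IH) auto
    then obtain xs a b ys where "gs = xs @ (a + b + 2) # ys" "i = p + g + 2 + extent xs + a"
      by blast
    then have "g # gs = (g # xs) @ (a + b + 2) # ys \<and> i = p + extent (g # xs) + a" by simp
    then show ?thesis by blast
  qed
qed simp

lemma split_start_free:
  assumes "j \<in> edge_starts p (xs @ (a + b + 2) # ys)"
  shows "p + extent xs + a + 2 \<le> j \<or> j + 2 \<le> p + extent xs + a"
  using assms
proof (induction xs arbitrary: p)
  case Nil
  then show ?case using edge_starts_bounds[of j "p + (a + b + 2) + 2" ys] by auto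
next
  case (Cons x xs)
  then show ?case using Cons.IH[of "p + x + 2"] by (auto simp: add_ac)
qed

section \<open>Legal moves as splittings of gaps\<close>

definition edge_at :: "nat \<Rightarrow> nat set" where
  "edge_at i = {i, i + 1}"

lemma inj_edge_at: "inj edge_at"
  by (rule injI) (auto simp: edge_at_def doubleton_eq_iff)

lemma disjnt_edge_at: "disjnt (edge_at i) (edge_at j) \<longleftrightarrow> i + 2 \<le> j \<or> j + 2 \<le> i"
  by (auto simp: edge_at_def disjnt_def)

lemma edges_path_graph: "edges (path_graph n) = edge_at ` {1..<n}"
  by (auto simp: edges_def path_graph_def edge_at_def)

text \<open>The start removed is that of the guard edge; see
  \<open>edge_starts_last\<close>.\<close>

definition gap_matching :: "nat list \<Rightarrow> nat set set" where
  "gap_matching gs = edge_at ` (edge_starts 1 gs - {extent gs - 1})"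

inductive gap_move :: "nat list \<Rightarrow> nat list \<Rightarrow> bool" where
  "gap_move (xs @ (a + b + 2) # ys) (xs @ a # b # ys)"

lemma gap_move_extent: "gap_move gs gs' \<Longrightarrow> extent gs' = extent gs"
  by (induction rule: gap_move.induct) simp

lemma gap_move_length: "gap_move gs gs' \<Longrightarrow> length gs' = Suc (length gs)"
  by (induction rule: gap_move.induct) simp

lemma gap_move_sum_list: "gap_move gs gs' \<Longrightarrow> sum_list gs' < sum_list gs"
  by (induction rule: gap_move.induct) simp

lemma gap_moveI:
  assumes "m \<in> set gs" "m = a + b + 2"
  obtains xs ys where "gs = xs @ m # ys" "gap_move gs (xs @ a # b # ys)"
  using assms by (metis gap_move.intros split_list)

lemma card_gap_matching:
  assumes "gs \<noteq> []"
  shows "card (gap_matching gs) = length gs - 1"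
  using edge_starts_last[OF assms, of 1] inj_edge_at
  by (simp add: gap_matching_def card_image inj_on_subset card_edge_starts)

text \<open>The guard edge starts at \<open>n + 1\<close> and stands for the end of the path: a
  start below \<open>n + 3\<close> that keeps away from it satisfies \<open>i < n\<close>.\<close>

lemma legal_moves_gap_matching:
  assumes "extent gs = n + 2"
  shows "legal_moves (path_graph n) (gap_matching gs)
    = edge_at ` {i. 1 \<le> i \<and> i < 1 + extent gs \<and> (\<forall>j\<in>edge_starts 1 gs. i + 2 \<le> j \<or> j + 2 \<le> i)}"
    (is "?L = edge_at ` ?I")
proof
  have "gs \<noteq> []" using assms by auto
  then have guard: "n + 1 \<in> edge_starts 1 gs"
    using edge_starts_last[of gs 1] assms by simp
  have M: "gap_matching gs = edge_at ` (edge_starts 1 gs - {n + 1})"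
    using assms by (simp add: gap_matching_def)
  have edge_iff: "edge_at i \<in> edge_at ` A \<longleftrightarrow> i \<in> A" for i A
    using inj_edge_at by (rule inj_image_mem_iff)
  show "?L \<subseteq> edge_at ` ?I"
  proof
    fix e
    assume e: "e \<in> ?L"
    then obtain i where i: "e = edge_at i" "1 \<le> i" "i < n"
      by (auto simp: legal_moves_def edges_path_graph)
    have notin: "e \<notin> gap_matching gs" using e by (simp add: legal_moves_def)
    have pw: "pairwise disjnt (insert e (gap_matching gs))"
      using e by (simp add: legal_moves_def matching_def)
    have "i + 2 \<le> j \<or> j + 2 \<le> i" if j: "j \<in> edge_starts 1 gs" for j
    proof (cases "j = n + 1")
      case False
      with j have jM: "edge_at j \<in> gap_matching gs" by (auto simp: M)
      then have "edge_at i \<noteq> edge_at j" using notin i(1) by auto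
      then have "disjnt (edge_at i) (edge_at j)"
        using pw jM i(1) by (auto simp: pairwise_insert)
      then show ?thesis by (simp add: disjnt_edge_at)
    qed (use i in simp)
    then show "e \<in> edge_at ` ?I" using i assms by auto
  qed
  show "edge_at ` ?I \<subseteq> ?L"
  proof
    fix e
    assume "e \<in> edge_at ` ?I"
    then obtain i where i: "e = edge_at i" "1 \<le> i" "i < n + 3"
      and apart: "\<And>j. j \<in> edge_starts 1 gs \<Longrightarrow> i + 2 \<le> j \<or> j + 2 \<le> i"
      using assms by auto
    have "i < n" using apart[OF guard] i(3) by auto
    \<comment> \<open>For \<open>j = i\<close> the conclusion of \<open>apart\<close> is absurd, so
      no edge of the position starts at \<open>i\<close>.\<close>
    have notin: "e \<notin> gap_matching gs"
      using apart[of i] by (auto simp: M i(1) edge_iff)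
    have "j < n" "1 \<le> j" if "j \<in> edge_starts 1 gs - {n + 1}" for j
      using that edge_starts_apart[of j 1 gs "n + 1"] edge_starts_bounds[of j 1 gs] guard assms
      by auto
    then have sub: "gap_matching gs \<subseteq> edges (path_graph n)"
      by (auto simp: M edges_path_graph)
    have "pairwise disjnt (gap_matching gs)"
      unfolding M pairwise_def using edge_starts_apart[of _ 1 gs] by (fastforce simp: disjnt_edge_at)
    moreover have "disjnt e f" if "f \<in> gap_matching gs" for f
      using that apart by (auto simp: M i(1) disjnt_edge_at)
    ultimately have "pairwise disjnt (insert e (gap_matching gs))"
      by (auto simp: pairwise_insert disjnt_sym)
    moreover have "e \<in> edges (path_graph n)"
      using i \<open>i < n\<close> by (auto simp: edges_path_graph)
    ultimately show "e \<in> ?L"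
      using sub notin by (simp add: legal_moves_def matching_def)
  qed
qed

text \<open>Successor positions are compared rather than moves, so that the equation can be
  substituted under the \<open>Max\<close> and \<open>Min\<close> of backward induction.\<close>

lemma legal_moves_eq_gap_moves:
  assumes "extent gs = n + 2"
  shows "(\<lambda>e. insert e (gap_matching gs)) ` legal_moves (path_graph n) (gap_matching gs)
    = gap_matching ` Collect (gap_move gs)"
proof -
  let ?free = "\<lambda>i. 1 \<le> i \<and> i < 1 + extent gs \<and> (\<forall>j\<in>edge_starts 1 gs. i + 2 \<le> j \<or> j + 2 \<le> i)"
  have insert_eq: "gap_matching (xs @ a # b # ys) = insert (edge_at (1 + extent xs + a)) (gap_matching gs)"
    if gs: "gs = xs @ (a + b + 2) # ys" for xs a b ys
  proof -
    have "extent (xs @ a # b # ys) = extent gs" and "1 + extent xs + a \<noteq> extent gs - 1"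
      by (simp_all add: gs)
    then show ?thesis
      unfolding gap_matching_def edge_starts_split gs[symmetric] by (simp add: insert_Diff_if)
  qed
  have free: "?free (1 + extent xs + a)" if gs: "gs = xs @ (a + b + 2) # ys" for xs a b ys
  proof (intro conjI ballI)
    show "1 + extent xs + a + 2 \<le> j \<or> j + 2 \<le> 1 + extent xs + a" if "j \<in> edge_starts 1 gs" for j
      using that unfolding gs by (rule split_start_free)
  qed (simp_all add: gs)
  show ?thesis
    unfolding legal_moves_gap_matching[OF assms]
  proof (intro equalityI subsetI)
    fix N
    assume "N \<in> (\<lambda>e. insert e (gap_matching gs)) ` edge_at ` Collect ?free"
    then obtain i where i: "?free i" "N = insert (edge_at i) (gap_matching gs)" by blast
    obtain xs a b ys where gs: "gs = xs @ (a + b + 2) # ys" "i = 1 + extent xs + a"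
      using free_start_split[of 1 i gs] i(1) by blast
    then have "N = gap_matching (xs @ a # b # ys)" using insert_eq i(2) by simp
    moreover have "gap_move gs (xs @ a # b # ys)" using gs(1) gap_move.intros by simp
    ultimately show "N \<in> gap_matching ` Collect (gap_move gs)" by blast
  next
    fix N
    assume "N \<in> gap_matching ` Collect (gap_move gs)"
    then obtain gs' where gs': "gap_move gs gs'" "N = gap_matching gs'" by blast
    from gs'(1) obtain xs a b ys where gs: "gs = xs @ (a + b + 2) # ys" "gs' = xs @ a # b # ys"
      by (auto elim: gap_move.cases)
    have "N = insert (edge_at (1 + extent xs + a)) (gap_matching gs)"
      using insert_eq[OF gs(1)] gs(2) gs'(2) by simp
    then show "N \<in> (\<lambda>e. insert e (gap_matching gs)) ` edge_at ` Collect ?free"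
      using free[OF gs(1)] by blast
  qed
qed

text \<open>Without the guard edge, the gaps and edges cover \<open>extent gs - 2\<close>
  vertices.\<close>

definition gap_value :: "player \<Rightarrow> nat list \<Rightarrow> nat" where
  "gap_value p gs = game_value (path_graph (extent gs - 2)) p (gap_matching gs)"

lemma game_matching_number_path: "game_matching_number (path_graph n) = gap_value Maximizer [n]"
  by (simp add: game_matching_number_def gap_value_def gap_matching_def)

section \<open>Optimal play on lists of gaps\<close>

context
  fixes gs :: "nat list"
  assumes nonempty: "gs \<noteq> []"
begin

private abbreviation "G \<equiv> path_graph (extent gs - 2)"

private lemma extent_eq: "extent gs = (extent gs - 2) + 2"
  using nonempty by (cases gs) auto

private lemma moves: "(\<lambda>e. insert e (gap_matching gs)) ` legal_moves G (gap_matching gs)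
    = gap_matching ` Collect (gap_move gs)"
  by (rule legal_moves_eq_gap_moves[OF extent_eq])

private lemma finite_edges_G: "finite (edges G)"
  by (rule finite_edges[OF finite_simple_path_graph])

private lemma move_values:
  "game_value G p ` (\<lambda>e. insert e (gap_matching gs)) ` legal_moves G (gap_matching gs)
    = gap_value p ` Collect (gap_move gs)"
  \<comment> \<open>Moves preserve \<open>extent\<close>, so the underlying path stays the
    same.\<close>
  unfolding moves image_image by (intro image_cong) (auto simp: gap_value_def gap_move_extent)

private lemma finite_values: "finite (gap_value p ` Collect (gap_move gs))"
  unfolding move_values[symmetric] using finite_edges_G
  by (intro finite_imageI) (simp add: legal_moves_def)

private lemma legal_nonempty:
  "legal_moves G (gap_matching gs) \<noteq> {} \<longleftrightarrow> Collect (gap_move gs) \<noteq> {}"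
  using arg_cong[OF moves, of "\<lambda>A. A = {}"] by (simp only: image_is_empty)

lemma gap_value_no_moves:
  assumes "\<nexists>gs'. gap_move gs gs'"
  shows "gap_value p gs = length gs - 1"
proof -
  have "legal_moves G (gap_matching gs) = {}" using assms legal_nonempty by blast
  then show ?thesis
    by (simp add: gap_value_def game_value_no_moves card_gap_matching[OF nonempty])
qed

private lemma gap_value_Maximizer:
  assumes "\<exists>gs'. gap_move gs gs'"
  shows "gap_value Maximizer gs = Max (gap_value Minimizer ` Collect (gap_move gs))"
proof -
  have "legal_moves G (gap_matching gs) \<noteq> {}" using assms legal_nonempty by blast
  then show ?thesis
    unfolding gap_value_def[of _ gs] move_values[symmetric]
    by (rule game_value_Maximizer[OF finite_edges_G])
qed

lemma gap_value_Maximizer_in: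
  assumes "\<exists>gs'. gap_move gs gs'"
  shows "\<exists>gs'. gap_move gs gs' \<and> gap_value Maximizer gs = gap_value Minimizer gs'"
proof -
  have "gap_value Maximizer gs \<in> gap_value Minimizer ` Collect (gap_move gs)"
    unfolding gap_value_Maximizer[OF assms] using assms finite_values by (intro Max_in) auto
  then show ?thesis by auto
qed

lemma gap_value_Maximizer_ge:
  assumes "gap_move gs gs'"
  shows "gap_value Minimizer gs' \<le> gap_value Maximizer gs"
proof -
  have "gap_value Maximizer gs = Max (gap_value Minimizer ` Collect (gap_move gs))"
    using assms by (intro gap_value_Maximizer) blast
  then show ?thesis using assms finite_values by simp
qed

private lemma gap_value_Minimizer:
  assumes "\<exists>gs'. gap_move gs gs'"
  shows "gap_value Minimizer gs = Min (gap_value Maximizer ` Collect (gap_move gs))"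
proof -
  have "legal_moves G (gap_matching gs) \<noteq> {}" using assms legal_nonempty by blast
  then show ?thesis
    unfolding gap_value_def[of _ gs] move_values[symmetric]
    by (rule game_value_Minimizer[OF finite_edges_G])
qed

lemma gap_value_Minimizer_in:
  assumes "\<exists>gs'. gap_move gs gs'"
  shows "\<exists>gs'. gap_move gs gs' \<and> gap_value Minimizer gs = gap_value Maximizer gs'"
proof -
  have "gap_value Minimizer gs \<in> gap_value Maximizer ` Collect (gap_move gs)"
    unfolding gap_value_Minimizer[OF assms] using assms finite_values by (intro Min_in) auto
  then show ?thesis by auto
qed

lemma gap_value_Minimizer_le:
  assumes "gap_move gs gs'"
  shows "gap_value Minimizer gs \<le> gap_value Maximizer gs'"
proof -
  have "gap_value Minimizer gs = Min (gap_value Maximizer ` Collect (gap_move gs))"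
    using assms by (intro gap_value_Minimizer) blast
  then show ?thesis using assms finite_values by simp
qed

end

section \<open>Potentials\<close>

definition cold :: "nat \<Rightarrow> bool" where
  "cold m \<longleftrightarrow> m < 6 \<and> m \<noteq> 4"

lemma cold_iff: "cold m \<longleftrightarrow> m \<in> {0, 1, 2, 3, 5}"
  by (auto simp: cold_def)

text \<open>The rounded halves fail to add up only if \<open>a\<close> and \<open>b\<close> are both
  odd. Then \<open>a + b + 2\<close> is even and at least \<open>4\<close>, hence not cold.\<close>

lemma cold_split:
  assumes "cold (a + b + 2)"
  shows "cold a" "cold b" "a div 2 + b div 2 + 1 = (a + b + 2) div 2"
proof -
  have "a \<le> 3" "b \<le> 3" using assms by (auto simp: cold_def)
  then have "a \<in> {0, 1, 2, 3}" "b \<in> {0, 1, 2, 3}" by auto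
  then show "cold a" "cold b" "a div 2 + b div 2 + 1 = (a + b + 2) div 2"
    using assms by (auto simp: cold_def)
qed

text \<open>A move in a cold gap raises the length by one and lowers the sum by one, so the
  right-hand side is invariant, whoever plays. The \<open>1\<close> on the left is the guard
  edge.\<close>

lemma gap_value_cold:
  assumes "gs \<noteq> []" "\<forall>m\<in>set gs. cold m"
  shows "gap_value p gs + 1 = length gs + (\<Sum>m\<leftarrow>gs. m div 2)"
  using assms
proof (induction "sum_list gs" arbitrary: gs p rule: less_induct)
  case less
  show ?case
  proof (cases "\<exists>gs'. gap_move gs gs'")
    case True
    obtain q gs' where gs': "gap_move gs gs'" "gap_value p gs = gap_value q gs'"
      using gap_value_Maximizer_in[OF less.prems(1) True] gap_value_Minimizer_in[OF less.prems(1) True]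
      by (cases p) auto
    from gs'(1) obtain xs a b ys where gs: "gs = xs @ (a + b + 2) # ys" "gs' = xs @ a # b # ys"
      by (auto elim: gap_move.cases)
    have m: "cold (a + b + 2)" using less.prems(2) gs(1) by simp
    have "gap_value q gs' + 1 = length gs' + (\<Sum>m\<leftarrow>gs'. m div 2)"
      using less.prems(2) gs cold_split[OF m] gap_move_sum_list[OF gs'(1)] by (intro less.hyps) auto
    then show ?thesis using gs gs'(2) cold_split(3)[OF m] by simp
  next
    case False
    have "m div 2 = 0" if "m \<in> set gs" for m
    proof (rule ccontr)
      assume "m div 2 \<noteq> 0"
      then have "m = 0 + (m - 2) + 2" by auto
      with that False show False by (metis gap_moveI)
    qed
    then have "(\<Sum>m\<leftarrow>gs. m div 2) = 0" by simp
    then show ?thesis using gap_value_no_moves[OF less.prems(1) False] less.prems(1) by (cases gs) auto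
  qed
qed

text \<open>The constants \<open>- 3\<close> here and \<open>+ 1\<close> in
  \<open>upper_weight\<close> are the minimum and the maximum of
  \<open>7 * (m div 2) - 3 * m\<close> over cold \<open>m\<close>, attained at \<open>1\<close> and
  \<open>2\<close>.\<close>

definition lower_weight :: "nat \<Rightarrow> nat" where
  "lower_weight m = (if cold m then 7 * (m div 2) else 3 * m - 3)"

definition upper_weight :: "nat \<Rightarrow> nat" where
  "upper_weight m = (if cold m then 7 * (m div 2) else 3 * m + 1)"

lemma sum_list_weight_cold:
  assumes "\<forall>m\<in>set gs. cold m"
  shows "sum_list (map lower_weight gs) = 7 * (\<Sum>m\<leftarrow>gs. m div 2)"
    and "sum_list (map upper_weight gs) = 7 * (\<Sum>m\<leftarrow>gs. m div 2)"
  using assms by (induction gs) (auto simp: lower_weight_def upper_weight_def)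

section \<open>Effect of one move on the weights\<close>

lemma lower_weight_ge: "3 * m \<le> lower_weight m + 3"
  by (auto simp: lower_weight_def cold_iff)

lemma upper_weight_le: "upper_weight m \<le> 3 * m + 1"
  by (auto simp: upper_weight_def cold_iff)

text \<open>The edge played counts \<open>7\<close>, so \<open>9\<close> lets a move cost Max at
  most \<open>2\<close>. A cold gap loses exactly \<open>7\<close>; otherwise the linear bounds on
  both parts suffice.\<close>

lemma lower_weight_split: "lower_weight (a + b + 2) \<le> lower_weight a + lower_weight b + 9"
proof (cases "cold (a + b + 2)")
  case True
  then show ?thesis using cold_split[OF True] by (simp add: lower_weight_def)
next
  case False
  then show ?thesis
    using lower_weight_ge[of a] lower_weight_ge[of b] by (simp add: lower_weight_def)
qed

text \<open>Here \<open>5 = 7 - 2\<close>: no move gains Max more than \<open>2\<close>.\<close>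

lemma upper_weight_split: "upper_weight a + upper_weight b + 5 \<le> upper_weight (a + b + 2)"
proof (cases "cold (a + b + 2)")
  case True
  then show ?thesis using cold_split[OF True] by (simp add: upper_weight_def)
next
  case False
  then show ?thesis
    using upper_weight_le[of a] upper_weight_le[of b] by (simp add: upper_weight_def)
qed

text \<open>The gap \<open>2\<close> has weight \<open>7\<close>, which is \<open>4\<close> above
  the line \<open>3 * m - 3\<close>; this turns a possible loss of \<open>2\<close> into a gain of
  \<open>2\<close>.\<close>

lemma lower_weight_best_split:
  assumes "\<not> cold m"
  shows "m = 2 + (m - 4) + 2" "lower_weight m \<le> lower_weight 2 + lower_weight (m - 4) + 5"
proof -
  have "4 \<le> m" using assms by (auto simp: cold_def)
  then show "m = 2 + (m - 4) + 2" by simp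
  have "lower_weight 2 = 7" by (simp add: lower_weight_def cold_def)
  then show "lower_weight m \<le> lower_weight 2 + lower_weight (m - 4) + 5"
    using assms lower_weight_ge[of "m - 4"] by (simp add: lower_weight_def[of m])
qed

text \<open>The gap \<open>1\<close> has weight \<open>0\<close>, which is \<open>4\<close> below
  the line \<open>3 * m + 1\<close>; Min thus gains \<open>2\<close> instead of losing
  \<open>2\<close>.\<close>

lemma upper_weight_best_split:
  assumes "\<not> cold m"
  shows "m = 1 + (m - 3) + 2" "upper_weight 1 + upper_weight (m - 3) + 9 \<le> upper_weight m"
proof -
  have m: "4 \<le> m" using assms by (auto simp: cold_def)
  then show "m = 1 + (m - 3) + 2" by simp
  have "upper_weight 1 = 0" by (simp add: upper_weight_def cold_def)
  then show "upper_weight 1 + upper_weight (m - 3) + 9 \<le> upper_weight m"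
    using assms m upper_weight_le[of "m - 3"] by (simp add: upper_weight_def[of m])
qed

text \<open>The \<open>2\<close> granted when Min is to move is what that move may cost; Max
  provides it by gaining \<open>2\<close> in a gap that is not cold.\<close>

lemma gap_value_lower:
  assumes "gs \<noteq> []"
  shows "sum_list (map lower_weight gs) + 7 * length gs
    \<le> 7 * gap_value p gs + 7 + (case p of Maximizer \<Rightarrow> 0 | Minimizer \<Rightarrow> 2)"
  using assms
proof (induction "sum_list gs" arbitrary: gs p rule: less_induct)
  case less
  \<comment> \<open>The extra edge of \<open>gs'\<close> adds \<open>7\<close> on the left, which
    cancels the \<open>7\<close> on the right.\<close>
  have IH: "sum_list (map lower_weight gs') + 7 * length gs
      \<le> 7 * gap_value q gs' + (case q of Maximizer \<Rightarrow> 0 | Minimizer \<Rightarrow> 2)"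
    if "gap_move gs gs'" for gs' q
    using less.hyps[of gs' q] gap_move_sum_list[OF that] gap_move_length[OF that] by fastforce
  show ?case
  proof (cases "\<forall>m\<in>set gs. cold m")
    case True
    then show ?thesis
      using gap_value_cold[OF less.prems True, of p] sum_list_weight_cold(1)[OF True] by simp
  next
    case False
    then obtain m where m: "m \<in> set gs" "\<not> cold m" by blast
    obtain xs ys where split: "gs = xs @ m # ys" "gap_move gs (xs @ 2 # (m - 4) # ys)"
      by (rule gap_moveI[OF m(1) lower_weight_best_split(1)[OF m(2)]])
    show ?thesis
    proof (cases p)
      case Maximizer
      have "gap_value Minimizer (xs @ 2 # (m - 4) # ys) \<le> gap_value Maximizer gs"
        by (rule gap_value_Maximizer_ge[OF less.prems split(2)])
      then show ?thesis
        using IH[OF split(2), of Minimizer] lower_weight_best_split(2)[OF m(2)] split(1) Maximizer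
        by simp
    next
      case Minimizer
      obtain gs' where gs': "gap_move gs gs'" "gap_value Minimizer gs = gap_value Maximizer gs'"
        using gap_value_Minimizer_in[OF less.prems] split(2) by blast
      from gs'(1) have "sum_list (map lower_weight gs) \<le> sum_list (map lower_weight gs') + 9"
      proof cases
        case (1 xs a b ys)
        then show ?thesis using lower_weight_split[of a b] by simp
      qed
      then show ?thesis using IH[OF gs'(1), of Maximizer] gs'(2) Minimizer by simp
    qed
  qed
qed

text \<open>Dually, the \<open>2\<close> is what Max's coming move may gain, and Min provides it by
  a move in a gap that is not cold.\<close>

lemma gap_value_upper:
  assumes "gs \<noteq> []"
  shows "7 * gap_value p gs + 7
    \<le> sum_list (map upper_weight gs) + 7 * length gs + (case p of Maximizer \<Rightarrow> 2 | Minimizer \<Rightarrow> 0)"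
  using assms
proof (induction "sum_list gs" arbitrary: gs p rule: less_induct)
  case less
  have IH: "7 * gap_value q gs'
      \<le> sum_list (map upper_weight gs') + 7 * length gs + (case q of Maximizer \<Rightarrow> 2 | Minimizer \<Rightarrow> 0)"
    if "gap_move gs gs'" for gs' q
    using less.hyps[of gs' q] gap_move_sum_list[OF that] gap_move_length[OF that] by fastforce
  show ?case
  proof (cases "\<forall>m\<in>set gs. cold m")
    case True
    then show ?thesis
      using gap_value_cold[OF less.prems True, of p] sum_list_weight_cold(2)[OF True] by simp
  next
    case False
    then obtain m where m: "m \<in> set gs" "\<not> cold m" by blast
    obtain xs ys where split: "gs = xs @ m # ys" "gap_move gs (xs @ 1 # (m - 3) # ys)"
      by (rule gap_moveI[OF m(1) upper_weight_best_split(1)[OF m(2)]])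
    show ?thesis
    proof (cases p)
      case Minimizer
      have "gap_value Minimizer gs \<le> gap_value Maximizer (xs @ 1 # (m - 3) # ys)"
        by (rule gap_value_Minimizer_le[OF less.prems split(2)])
      then show ?thesis
        using IH[OF split(2), of Maximizer] upper_weight_best_split(2)[OF m(2)] split(1) Minimizer
        by simp
    next
      case Maximizer
      obtain gs' where gs': "gap_move gs gs'" "gap_value Maximizer gs = gap_value Minimizer gs'"
        using gap_value_Maximizer_in[OF less.prems] split(2) by blast
      from gs'(1) have "sum_list (map upper_weight gs') + 5 \<le> sum_list (map upper_weight gs)"
      proof cases
        case (1 xs a b ys)
        then show ?thesis using upper_weight_split[of a b] by simp
      qed
      then show ?thesis using IH[OF gs'(1), of Minimizer] gs'(2) Maximizer by simp
    qed
  qed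
qed

theorem theorem5p2:
  fixes n :: nat
  assumes "n > 0"
  shows "3 * \<lfloor>real n / 7\<rfloor> \<le> int (game_matching_number (path_graph n)) \<and>
         int (game_matching_number (path_graph n)) \<le> 3 * \<lceil>real n / 7\<rceil>"
proof -
  let ?v = "game_matching_number (path_graph n)"
  have lower: "3 * n \<le> 7 * ?v + 3"
    using gap_value_lower[of "[n]" Maximizer] lower_weight_ge[of n]
    by (simp add: game_matching_number_path)
  \<comment> \<open>Of the \<open>3\<close>, the weight of \<open>n\<close> contributes
    \<open>1\<close> and Max's first move \<open>2\<close>.\<close>
  have upper: "7 * ?v \<le> 3 * n + 3"
    using gap_value_upper[of "[n]" Maximizer] upper_weight_le[of n]
    by (simp add: game_matching_number_path)
  have "7 * \<lfloor>real n / 7\<rfloor> \<le> int n" by linarith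
  moreover have "int n \<le> 7 * \<lceil>real n / 7\<rceil>" by linarith
  \<comment> \<open>Both bounds miss by at most \<open>3 / 7\<close>, which is less than
    \<open>1\<close>, so integrality removes the error.\<close>
  ultimately show ?thesis using lower upper by linarith
qed

end
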